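(* Let $S_n$ be the symmetric group on $\{1,\dots,n\}$ and $\pi_n$ the uniform distribution on $S_n$. For any non-empty $A\subseteq S_n$ $$\pi_n(A)\;\mathbb E_{\pi_n}\exp\Big(\frac{d_T(\cdot,A)^2}{144}\Big)\le1 .$$
   Context: A permutation $\sigma\in S_n$ is identified with the vector $(\sigma(1),\dots,\sigma(n))\in\{1,\dots,n\}^n$. For $\omega=(\omega_1,\dots,\omega_n)\in\Omega^n$ and $A\subset\Omega^n$, Talagrand's convex distance is $$d_T(\omega,A)=\sup_{\alpha\in\mathbb R^n:\,|\alpha|_2=1}d_\alpha(\omega,A),\qquad d_\alpha(\omega,A)=\inf_{\omega'\in A}\sum_{i=1}^n|\alpha_i|\,\mathbf 1_{\omega_i\ne\omega_i'} ,$$ where $|\cdot|_2$ is the Euclidean norm. *)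

theory Defs
  imports "HOL-Probability.Probability" "HOL-Combinatorics.Permutations"
begin

(* A vector of length n is a function on nat, of which only the coordinates 1..n are
   ever inspected.  A permutation of {1..n} is thereby literally its own vector of values. *)

definition d_weighted :: "nat \<Rightarrow> (nat \<Rightarrow> real) \<Rightarrow> (nat \<Rightarrow> 'a) \<Rightarrow> (nat \<Rightarrow> 'a) set \<Rightarrow> real" where
  "d_weighted n \<alpha> \<omega> A = (INF \<omega>'\<in>A. \<Sum>i=1..n. \<bar>\<alpha> i\<bar> * of_bool (\<omega> i \<noteq> \<omega>' i))"

(* Real-valued Sup and Inf: for n > 0 and A nonempty, d_weighted lies in [0, sqrt n] on the
   unit sphere, so both are taken over nonempty bounded sets.  For n = 0 the sphere is
   empty, and for A = {} the infimum is over the empty set; then the value is meaningless. *)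
definition d_T :: "nat \<Rightarrow> (nat \<Rightarrow> 'a) \<Rightarrow> (nat \<Rightarrow> 'a) set \<Rightarrow> real" where
  "d_T n \<omega> A = (SUP \<alpha>\<in>{\<alpha>. L2_set \<alpha> {1..n} = 1}. d_weighted n \<alpha> \<omega> A)"

definition Sym :: "nat \<Rightarrow> (nat \<Rightarrow> nat) set" where
  "Sym n = {\<sigma>. \<sigma> permutes {1..n}}"

definition unif_Sym :: "nat \<Rightarrow> (nat \<Rightarrow> nat) pmf" where
  "unif_Sym n = pmf_of_set (Sym n)"

end

theory Submission
  imports Defs
begin

text \<open>Talagrand's induction for the symmetric group. Write \<open>V(\<sigma>)\<close> for the convex hull of the
  disagreement vectors of \<open>\<sigma>\<close> with the elements of \<open>A\<close>; by Cauchy--Schwarz, \<open>d_T \<sigma> A\<close> is at most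
  the norm of any \<open>x \<in> V(\<sigma>)\<close>. The induction on the number of points controls
  \<open>|x|\<^sup>2 + x\<^sub>l\<^sup>2\<close>, with one coordinate counted twice. Split the permutations by the value \<open>\<sigma> l\<close>, and
  let \<open>l\<close> itself be the value of the largest slice of \<open>A\<close> (after a left multiplication). A
  permutation with \<open>\<sigma> l = i\<close> is moved into that slice by a transposition which changes it only at
  \<open>l\<close> and at \<open>m = \<sigma>\<^sup>-\<^sup>1 l\<close>. Interpolating with weight \<open>\<theta>\<close> between a vector \<open>y\<close> for the slice of
  \<open>\<sigma>\<close> and a vector \<open>x\<close> for the largest one costs \<open>4 (1 - \<theta>)\<^sup>2\<close>, provided that \<open>y\<^sub>m\<close> is counted
  twice. The position \<open>m\<close> depends on \<open>\<sigma>\<close>, but it is a fixed coordinate for \<open>\<sigma>\<^sup>-\<^sup>1\<close>, so the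
  induction hypothesis applied to the inverses provides such a \<open>y\<close>. The constant 144 (rather than
  the 16 of Talagrand) leaves enough room to use the convexity of \<open>exp\<close> in place of Hoelder's
  inequality.\<close>

section \<open>Hulls of disagreement vectors\<close>

text \<open>The upward closure of the convex hull of the disagreement vectors, described by its support
  functional: every nonnegative linear functional is at least as large at \<open>x\<close> as at some
  disagreement vector.\<close>

definition diff_hull :: "'a set \<Rightarrow> ('a \<Rightarrow> 'b) set \<Rightarrow> ('a \<Rightarrow> 'b) \<Rightarrow> ('a \<Rightarrow> real) set" where
  "diff_hull S A \<sigma> = {x. \<forall>w. (\<forall>k. 0 \<le> w k) \<longrightarrow>
     (\<exists>\<tau>\<in>A. (\<Sum>k\<in>S. w k * of_bool (\<tau> k \<noteq> \<sigma> k)) \<le> (\<Sum>k\<in>S. w k * x k))}"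

lemma diff_hullI:
  assumes "\<And>w. \<forall>k. 0 \<le> w k \<Longrightarrow>
    \<exists>\<tau>\<in>A. (\<Sum>k\<in>S. w k * of_bool (\<tau> k \<noteq> \<sigma> k)) \<le> (\<Sum>k\<in>S. w k * x k)"
  shows "x \<in> diff_hull S A \<sigma>"
  using assms unfolding diff_hull_def by blast

lemma diff_hullD:
  assumes "x \<in> diff_hull S A \<sigma>" "\<forall>k. 0 \<le> w k"
  shows "\<exists>\<tau>\<in>A. (\<Sum>k\<in>S. w k * of_bool (\<tau> k \<noteq> \<sigma> k)) \<le> (\<Sum>k\<in>S. w k * x k)"
  using assms unfolding diff_hull_def by blast

text \<open>A linear functional at a convex combination is at least the smaller of its values at
  \<open>x\<close> and \<open>y\<close>, so the disagreement vector found for that point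
  serves.\<close>

lemma diff_hull_convex:
  assumes "x \<in> diff_hull S A \<sigma>" "y \<in> diff_hull S A \<sigma>" "0 \<le> \<theta>" "\<theta> \<le> 1"
  shows "(\<lambda>k. \<theta> * y k + (1 - \<theta>) * x k) \<in> diff_hull S A \<sigma>"
proof (rule diff_hullI)
  fix w :: "'a \<Rightarrow> real" assume w: "\<forall>k. 0 \<le> w k"
  obtain \<tau> where \<tau>: "\<tau> \<in> A" "(\<Sum>k\<in>S. w k * of_bool (\<tau> k \<noteq> \<sigma> k)) \<le> (\<Sum>k\<in>S. w k * x k)"
    using diff_hullD[OF assms(1) w] by blast
  obtain \<tau>' where \<tau>': "\<tau>' \<in> A" "(\<Sum>k\<in>S. w k * of_bool (\<tau>' k \<noteq> \<sigma> k)) \<le> (\<Sum>k\<in>S. w k * y k)"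
    using diff_hullD[OF assms(2) w] by blast
  define a b where "a = (\<Sum>k\<in>S. w k * x k)" and "b = (\<Sum>k\<in>S. w k * y k)"
  have eq: "(\<Sum>k\<in>S. w k * (\<theta> * y k + (1 - \<theta>) * x k)) = \<theta> * b + (1 - \<theta>) * a"
    unfolding a_def b_def sum_distrib_left sum.distrib[symmetric]
    by (rule sum.cong) (auto simp: algebra_simps)
  have "min a b \<le> \<theta> * b + (1 - \<theta>) * a"
    using convex_bound_le[of "- b" "- min a b" "- a" \<theta> "1 - \<theta>"] assms(3,4) by simp
  thus "\<exists>\<tau>\<in>A. (\<Sum>k\<in>S. w k * of_bool (\<tau> k \<noteq> \<sigma> k)) \<le> (\<Sum>k\<in>S. w k * (\<theta> * y k + (1 - \<theta>) * x k))"
    unfolding eq using \<tau> \<tau>' unfolding a_def[symmetric] b_def[symmetric]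
    by (meson min_le_iff_disj order_trans)
qed

text \<open>An injective map applied to the values leaves the positions of disagreement
  unchanged.\<close>

lemma diff_hull_left_mult:
  fixes \<pi> :: "'b \<Rightarrow> 'c" and \<sigma> :: "'a \<Rightarrow> 'b"
  assumes "inj \<pi>" "x \<in> diff_hull S ((\<circ>) \<pi> ` A) (\<pi> \<circ> \<sigma>)"
  shows "x \<in> diff_hull S A \<sigma>"
proof (rule diff_hullI)
  fix w :: "'a \<Rightarrow> real" assume w: "\<forall>k. 0 \<le> w k"
  from diff_hullD[OF assms(2) w] obtain \<tau> where "\<tau> \<in> A"
    "(\<Sum>k\<in>S. w k * of_bool ((\<pi> \<circ> \<tau>) k \<noteq> (\<pi> \<circ> \<sigma>) k)) \<le> (\<Sum>k\<in>S. w k * x k)" by blast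
  thus "\<exists>\<tau>\<in>A. (\<Sum>k\<in>S. w k * of_bool (\<tau> k \<noteq> \<sigma> k)) \<le> (\<Sum>k\<in>S. w k * x k)"
    using assms(1) by (auto simp: inj_eq)
qed

text \<open>The value \<open>\<sigma> k\<close> of \<open>\<sigma>\<close> is a position of \<open>inv \<sigma>\<close>, and \<open>\<sigma>\<close>, \<open>\<tau>\<close> agree at \<open>k\<close> iff their
  inverses agree at \<open>\<sigma> k\<close>.\<close>

lemma diff_hull_inv:
  assumes S: "\<And>\<tau>. \<tau> \<in> A \<Longrightarrow> \<tau> permutes S" "\<sigma> permutes S"
    and x: "x \<in> diff_hull S (inv ` A) (inv \<sigma>)"
  shows "x \<circ> \<sigma> \<in> diff_hull S A \<sigma>"
proof (rule diff_hullI)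
  fix w :: "'a \<Rightarrow> real" assume w: "\<forall>k. 0 \<le> w k"
  from diff_hullD[OF x, of "w \<circ> inv \<sigma>"] w obtain \<tau> where \<tau>: "\<tau> \<in> A"
    "(\<Sum>k\<in>S. (w \<circ> inv \<sigma>) k * of_bool (inv \<tau> k \<noteq> inv \<sigma> k)) \<le> (\<Sum>k\<in>S. (w \<circ> inv \<sigma>) k * x k)"
    by auto
  have "inv \<tau> (\<sigma> k) \<noteq> k \<longleftrightarrow> \<tau> k \<noteq> \<sigma> k" for k
    using permutes_inverses[OF S(1)[OF \<tau>(1)]] by metis
  hence "(\<Sum>k\<in>S. w k * of_bool (\<tau> k \<noteq> \<sigma> k)) \<le> (\<Sum>k\<in>S. w k * (x \<circ> \<sigma>) k)"
    using \<tau>(2) sum.permute[OF S(2), of "\<lambda>k. (w \<circ> inv \<sigma>) k * of_bool (inv \<tau> k \<noteq> inv \<sigma> k)"]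
      sum.permute[OF S(2), of "\<lambda>k. (w \<circ> inv \<sigma>) k * x k"]
    by (simp add: o_def permutes_inverses[OF S(2)])
  with \<tau>(1) show "\<exists>\<tau>\<in>A. (\<Sum>k\<in>S. w k * of_bool (\<tau> k \<noteq> \<sigma> k)) \<le> (\<Sum>k\<in>S. w k * (x \<circ> \<sigma>) k)"
    by blast
qed

text \<open>Transport of a hull point from \<open>B\<close> to \<open>A\<close> along
  \<open>f\<close>. On \<open>D\<close>, where \<open>f\<close> may create new disagreements, the
  full price 1 is paid; elsewhere on \<open>T\<close> the entries of \<open>x\<close> suffice, and
  off \<open>T\<close> nothing is due. Accordingly \<open>x\<close> is tested with the weight on
  \<open>D\<close> erased.\<close>

lemma diff_hull_change:
  assumes x: "x \<in> diff_hull T B \<rho>" and S: "finite S" "T \<subseteq> S" "D \<subseteq> S"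
    and B: "\<And>\<tau>. \<tau> \<in> B \<Longrightarrow> f \<tau> \<in> A"
    and f: "\<And>\<tau> k. \<tau> \<in> B \<Longrightarrow> k \<in> S - D \<Longrightarrow> (k \<in> T \<Longrightarrow> \<tau> k = \<rho> k) \<Longrightarrow> f \<tau> k = \<sigma> k"
  shows "(\<lambda>k. if k \<in> D then 1 else if k \<in> T then x k else 0) \<in> diff_hull S A \<sigma>"
proof (rule diff_hullI)
  fix w :: "'a \<Rightarrow> real" assume w: "\<forall>k. 0 \<le> w k"
  let ?w = "\<lambda>k. if k \<in> D then 0 else w k"
  have "\<forall>k. 0 \<le> ?w k" using w by simp
  from diff_hullD[OF x this] obtain \<tau> where \<tau>: "\<tau> \<in> B"
    "(\<Sum>k\<in>T. ?w k * of_bool (\<tau> k \<noteq> \<rho> k)) \<le> (\<Sum>k\<in>T. ?w k * x k)" by blast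
  have restrict: "(\<Sum>k\<in>T. ?w k * g k) = (\<Sum>k\<in>S-D. w k * (if k \<in> T then g k else 0))" for g
  proof -
    have "(\<Sum>k\<in>T. ?w k * g k) = (\<Sum>k\<in>S. ?w k * (if k \<in> T then g k else 0))"
      using S by (intro sum.mono_neutral_cong_left) auto
    also have "\<dots> = (\<Sum>k\<in>S-D. w k * (if k \<in> T then g k else 0))"
      using S by (intro sum.mono_neutral_cong_right) auto
    finally show ?thesis .
  qed
  have split: "sum g S = sum g (S - D) + sum g D" for g :: "'a \<Rightarrow> real"
    by (rule sum.subset_diff[OF S(3,1)])
  have "(\<Sum>k\<in>S. w k * of_bool (f \<tau> k \<noteq> \<sigma> k)) \<le>
        (\<Sum>k\<in>S-D. w k * (if k \<in> T then of_bool (\<tau> k \<noteq> \<rho> k) else 0)) + (\<Sum>k\<in>D. w k)"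
    unfolding split using f[OF \<tau>(1)] w
    by (intro add_mono sum_mono mult_left_mono) (auto simp: of_bool_def)
  also have "\<dots> \<le> (\<Sum>k\<in>S-D. w k * (if k \<in> T then x k else 0)) + (\<Sum>k\<in>D. w k)"
    using \<tau>(2) unfolding restrict by simp
  also have "\<dots> = (\<Sum>k\<in>S. w k * (if k \<in> D then 1 else if k \<in> T then x k else 0))"
    unfolding split by (intro arg_cong2[of _ _ _ _ "(+)"] sum.cong) auto
  finally show "\<exists>\<tau>\<in>A. (\<Sum>k\<in>S. w k * of_bool (\<tau> k \<noteq> \<sigma> k)) \<le>
      (\<Sum>k\<in>S. w k * (if k \<in> D then 1 else if k \<in> T then x k else 0))"
    using B[OF \<tau>(1)] by blast
qed

section \<open>The convex distance and norms of hull points\<close>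

lemma d_T_le:
  assumes "n \<ge> 1" "A \<noteq> {}" and x: "x \<in> diff_hull {1..n} A \<omega>"
  shows "(d_T n \<omega> A)\<^sup>2 \<le> (\<Sum>k=1..n. (x k)\<^sup>2)"
proof -
  define U where "U = {\<alpha> :: nat \<Rightarrow> real. L2_set \<alpha> {1..n} = 1}"
  have bdd: "bdd_below ((\<lambda>\<omega>'. \<Sum>i=1..n. \<bar>\<alpha> i\<bar> * of_bool (\<omega> i \<noteq> \<omega>' i)) ` A)" for \<alpha> :: "nat \<Rightarrow> real"
    by (rule bdd_belowI2[of _ 0]) (simp add: sum_nonneg)
  have le: "d_weighted n \<alpha> \<omega> A \<le> L2_set x {1..n}" if "\<alpha> \<in> U" for \<alpha>
  proof -
    obtain \<tau> where \<tau>: "\<tau> \<in> A"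
      "(\<Sum>k=1..n. \<bar>\<alpha> k\<bar> * of_bool (\<tau> k \<noteq> \<omega> k)) \<le> (\<Sum>k=1..n. \<bar>\<alpha> k\<bar> * x k)"
      using diff_hullD[OF x, of "\<lambda>k. \<bar>\<alpha> k\<bar>"] by auto
    have "d_weighted n \<alpha> \<omega> A \<le> (\<Sum>k=1..n. \<bar>\<alpha> k\<bar> * of_bool (\<omega> k \<noteq> \<tau> k))"
      unfolding d_weighted_def by (rule cINF_lower[OF bdd \<tau>(1)])
    also have "\<dots> = (\<Sum>k=1..n. \<bar>\<alpha> k\<bar> * of_bool (\<tau> k \<noteq> \<omega> k))"
      by (intro sum.cong) auto
    also have "\<dots> \<le> (\<Sum>k=1..n. \<bar>\<alpha> k\<bar> * \<bar>x k\<bar>)"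
      by (rule order_trans[OF \<tau>(2)]) (intro sum_mono mult_left_mono, auto)
    also have "\<dots> \<le> L2_set \<alpha> {1..n} * L2_set x {1..n}"
      by (rule L2_set_mult_ineq)
    finally show ?thesis using that by (simp add: U_def)
  qed
  \<comment> \<open>A basis vector shows that the unit sphere is nonempty, so the supremum is a
    genuine one. It also yields \<open>0 \<le> d_T n \<omega> A\<close>, which squaring
    requires.\<close>
  have "(\<lambda>i. of_bool (i = 1)) \<in> U"
    using assms(1) by (simp add: U_def L2_set_def power2_eq_square if_distrib of_bool_def sum.delta cong: if_cong)
  then obtain \<alpha>0 where \<alpha>0: "\<alpha>0 \<in> U" by blast
  have "d_T n \<omega> A \<le> L2_set x {1..n}"
    unfolding d_T_def U_def[symmetric] using \<alpha>0 le by (intro cSUP_least) auto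
  moreover have "0 \<le> d_weighted n \<alpha>0 \<omega> A"
    unfolding d_weighted_def using assms(2) by (intro cINF_greatest) (auto intro: sum_nonneg)
  moreover have "d_weighted n \<alpha>0 \<omega> A \<le> d_T n \<omega> A"
    unfolding d_T_def U_def[symmetric] using \<alpha>0 le by (intro cSUP_upper bdd_aboveI2) auto
  ultimately have "(d_T n \<omega> A)\<^sup>2 \<le> (L2_set x {1..n})\<^sup>2"
    by (intro power_mono) auto
  thus ?thesis by (simp add: L2_set_def sum_nonneg)
qed

section \<open>The exponential moment bound and its symmetries\<close>

text \<open>\<open>c \<sigma>\<close> is the weight of the coordinates of \<open>x \<sigma>\<close>: all ones, except for one coordinate that may
  be counted twice.\<close>

definition hull_exp_bound :: "'a set \<Rightarrow> ('a \<Rightarrow> 'a) set \<Rightarrow> (('a \<Rightarrow> 'a) \<Rightarrow> 'a \<Rightarrow> real) \<Rightarrow> bool" where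
  "hull_exp_bound S A c \<longleftrightarrow> (\<exists>x. (\<forall>\<sigma>. \<sigma> permutes S \<longrightarrow> x \<sigma> \<in> diff_hull S A \<sigma>) \<and>
     real (card A) * (\<Sum>\<sigma> | \<sigma> permutes S. exp ((\<Sum>k\<in>S. c \<sigma> k * (x \<sigma> k)\<^sup>2) / 144)) \<le> (fact (card S))\<^sup>2)"

lemma hull_exp_bound_mono:
  assumes "hull_exp_bound S A c" "\<And>\<sigma> k. \<sigma> permutes S \<Longrightarrow> k \<in> S \<Longrightarrow> c' \<sigma> k \<le> c \<sigma> k"
  shows "hull_exp_bound S A c'"
proof -
  obtain x where x: "\<And>\<sigma>. \<sigma> permutes S \<Longrightarrow> x \<sigma> \<in> diff_hull S A \<sigma>"
    "real (card A) * (\<Sum>\<sigma> | \<sigma> permutes S. exp ((\<Sum>k\<in>S. c \<sigma> k * (x \<sigma> k)\<^sup>2) / 144)) \<le> (fact (card S))\<^sup>2"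
    using assms(1) unfolding hull_exp_bound_def by blast
  have "real (card A) * (\<Sum>\<sigma> | \<sigma> permutes S. exp ((\<Sum>k\<in>S. c' \<sigma> k * (x \<sigma> k)\<^sup>2) / 144))
     \<le> real (card A) * (\<Sum>\<sigma> | \<sigma> permutes S. exp ((\<Sum>k\<in>S. c \<sigma> k * (x \<sigma> k)\<^sup>2) / 144))"
    using assms(2) by (intro mult_left_mono sum_mono)
      (auto intro!: divide_right_mono sum_mono mult_right_mono)
  with x show ?thesis unfolding hull_exp_bound_def by (meson order_trans)
qed

text \<open>Reindexing the sum by left multiplication with \<open>\<pi>\<close>. This lets the
  induction rename values so that the largest slice is the one fixing \<open>l\<close>.\<close>

lemma hull_exp_bound_left_mult:
  assumes "\<pi> permutes S" "hull_exp_bound S ((\<circ>) \<pi> ` A) (\<lambda>_. c)"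
  shows "hull_exp_bound S A (\<lambda>_. c)"
proof -
  obtain x where x: "\<And>\<sigma>. \<sigma> permutes S \<Longrightarrow> x \<sigma> \<in> diff_hull S ((\<circ>) \<pi> ` A) \<sigma>"
    "real (card ((\<circ>) \<pi> ` A)) * (\<Sum>\<sigma> | \<sigma> permutes S. exp ((\<Sum>k\<in>S. c k * (x \<sigma> k)\<^sup>2) / 144)) \<le> (fact (card S))\<^sup>2"
    using assms(2) unfolding hull_exp_bound_def by blast
  have inj: "inj \<pi>" using assms(1) by (rule permutes_inj)
  have "inj_on ((\<circ>) \<pi>) A" by (rule inj_onI) (metis inj fun.inj_map_strong inj_eq)
  hence card: "card ((\<circ>) \<pi> ` A) = card A" by (rule card_image)
  have "(\<Sum>\<sigma> | \<sigma> permutes S. exp ((\<Sum>k\<in>S. c k * (x \<sigma> k)\<^sup>2) / 144))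
      = (\<Sum>\<sigma> | \<sigma> permutes S. exp ((\<Sum>k\<in>S. c k * (x (\<pi> \<circ> \<sigma>) k)\<^sup>2) / 144))"
    by (rule setum_permutations_compose_left[OF assms(1)])
  moreover have "x (\<pi> \<circ> \<sigma>) \<in> diff_hull S A \<sigma>" if "\<sigma> permutes S" for \<sigma>
    using x(1)[OF permutes_compose[OF that assms(1)]] diff_hull_left_mult[OF inj] by blast
  ultimately show ?thesis using x(2) unfolding hull_exp_bound_def card
    by (intro exI[of _ "\<lambda>\<sigma>. x (\<pi> \<circ> \<sigma>)"]) auto
qed

text \<open>Passing to inverses turns a coordinate fixed in advance into a position depending on
  \<open>\<sigma>\<close>: doubling \<open>i\<close> for the inverses doubles the position that
  \<open>\<sigma>\<close> sends to \<open>i\<close>.\<close>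

lemma hull_exp_bound_inv:
  assumes A: "\<And>\<tau>. \<tau> \<in> A \<Longrightarrow> \<tau> permutes S" and b: "hull_exp_bound S (inv ` A) (\<lambda>_. c)"
  shows "hull_exp_bound S A (\<lambda>\<sigma> k. c (\<sigma> k))"
proof -
  obtain x where x: "\<And>\<sigma>. \<sigma> permutes S \<Longrightarrow> x \<sigma> \<in> diff_hull S (inv ` A) \<sigma>"
    "real (card (inv ` A)) * (\<Sum>\<sigma> | \<sigma> permutes S. exp ((\<Sum>k\<in>S. c k * (x \<sigma> k)\<^sup>2) / 144)) \<le> (fact (card S))\<^sup>2"
    using b unfolding hull_exp_bound_def by blast
  have "inj_on inv A"
    by (rule inj_onI) (metis A permutes_inv_inv)
  hence card: "card (inv ` A) = card A" by (rule card_image)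
  have "(\<Sum>k\<in>S. c (\<sigma> k) * (x (inv \<sigma>) (\<sigma> k))\<^sup>2) = (\<Sum>k\<in>S. c k * (x (inv \<sigma>) k)\<^sup>2)" if "\<sigma> permutes S" for \<sigma>
    using sum.permute[OF that, of "\<lambda>k. c k * (x (inv \<sigma>) k)\<^sup>2"] by (simp add: o_def)
  hence "(\<Sum>\<sigma> | \<sigma> permutes S. exp ((\<Sum>k\<in>S. c (\<sigma> k) * (x (inv \<sigma>) (\<sigma> k))\<^sup>2) / 144))
      = (\<Sum>\<sigma> | \<sigma> permutes S. exp ((\<Sum>k\<in>S. c k * (x (inv \<sigma>) k)\<^sup>2) / 144))"
    by (intro sum.cong) auto
  also have "\<dots> = (\<Sum>\<sigma> | \<sigma> permutes S. exp ((\<Sum>k\<in>S. c k * (x \<sigma> k)\<^sup>2) / 144))"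
    using sum_permutations_inverse[of "\<lambda>\<sigma>. exp ((\<Sum>k\<in>S. c k * (x \<sigma> k)\<^sup>2) / 144)" S] by simp
  finally show ?thesis using x(2) diff_hull_inv[OF A] x(1)[OF permutes_inv] unfolding hull_exp_bound_def card
    by (intro exI[of _ "\<lambda>\<sigma>. x (inv \<sigma>) \<circ> \<sigma>"]) auto
qed

section \<open>Interpolation between two slices\<close>

text \<open>\<open>\<theta> / r + (1 - \<theta>)\<close> is the bound that convexity of \<open>exp\<close> gives for the interpolation between
  slices with size ratio \<open>r\<close>. The weight is \<open>\<theta> = max 0 (2 * r - 1)\<close>; for \<open>r = 0\<close> it must vanish,
  since then \<open>\<theta> / r\<close> is a junk value.\<close>

lemma interpolation_weight:
  fixes r :: real
  assumes "0 \<le> r" "r \<le> 1"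
  obtains \<theta> where "0 \<le> \<theta>" "\<theta> \<le> 1" "\<theta> = 0 \<or> 0 < r"
    "exp ((1 - \<theta>)\<^sup>2 / 36) * (\<theta> / r + (1 - \<theta>)) \<le> 2 - r"
proof (cases "r \<le> 1/2")
  case True
  \<comment> \<open>With weight 0 the left side is \<open>exp (1/36)\<close>, which is at most 3/2
    and hence at most \<open>2 - r\<close>.\<close>
  have "exp (1/36) \<le> (1 + 2 * (1/36) :: real)" using exp_bound_lemma[of "1/36::real"] by simp
  with True that[of 0] show ?thesis by simp
next
  case False
  \<comment> \<open>For \<open>\<theta> = 2 * r - 1\<close> one has
    \<open>1 - \<theta> = 2 * d\<close>, and the target is \<open>1 + d\<close>. A truncated
    geometric series bounds \<open>1 / r\<close> from below, which leaves a term
    \<open>- d\<^sup>2\<close>; it absorbs the \<open>4/9 * d\<^sup>2\<close> coming from the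
    exponential.\<close>
  define d where "d = 1 - r"
  have d: "0 \<le> d" "d \<le> 1/2" and r: "r = 1 - d" using assms False by (auto simp: d_def)
  have "2 * d * (2 * d) \<le> 1 * 1" using d by (intro mult_mono) auto
  hence small: "(2 * d)\<^sup>2 / 36 \<le> 1/2" by (simp add: power2_eq_square)
  have "exp ((2 * d)\<^sup>2 / 36) \<le> 1 + 2 * ((2 * d)\<^sup>2 / 36)"
    using exp_bound_lemma[of "(2 * d)\<^sup>2 / 36"] small by simp
  hence e: "exp ((2 * d)\<^sup>2 / 36) \<le> 1 + 2/9 * d\<^sup>2" by (simp add: power2_eq_square)
  have "(1 + d + d\<^sup>2) * r = 1 - d ^ 3" by (simp add: r power2_eq_square power3_eq_cube algebra_simps)
  hence "(1 + d + d\<^sup>2) * r \<le> 1" using d by simp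
  hence "1 + d + d\<^sup>2 \<le> 1 / r" using d by (simp add: r pos_le_divide_eq)
  moreover have "(2 * r - 1) / r = 2 - 1 / r" using d by (simp add: r field_simps)
  ultimately have q: "(2 * r - 1) / r + 2 * d \<le> 1 + d - d\<^sup>2" by simp
  have d2: "d\<^sup>2 \<le> d" using d by (simp add: power2_eq_square mult_left_le)
  have "exp ((2 * d)\<^sup>2 / 36) * ((2 * r - 1) / r + 2 * d) \<le> exp ((2 * d)\<^sup>2 / 36) * (1 + d - d\<^sup>2)"
    using q by (intro mult_left_mono) auto
  also have "\<dots> \<le> (1 + 2/9 * d\<^sup>2) * (1 + d - d\<^sup>2)"
    using e d2 by (intro mult_right_mono) auto
  also have "\<dots> = 1 + d - d\<^sup>2 + 2/9 * (d\<^sup>2 * (1 + d - d\<^sup>2))"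
    by (simp only: distrib_right mult_1 mult.assoc)
  also have "\<dots> \<le> 1 + d - d\<^sup>2 + 2/9 * (d\<^sup>2 * 2)"
    using d zero_le_power2[of d] by (intro add_left_mono mult_left_mono) linarith+
  also have "\<dots> \<le> 1 + d" by simp
  finally show ?thesis using d by (intro that[of "2 * r - 1"]) (auto simp: r)
qed

text \<open>\<open>B v\<close> is the slice of \<open>A\<close> sending \<open>l\<close> to
  \<open>v\<close>, carried over to permutations of \<open>T\<close>, and
  \<open>transpose l i \<circ> \<rho>\<close> runs through all permutations sending \<open>l\<close>
  to \<open>i\<close>. For \<open>i = l\<close> the hull point of the largest slice is used alone;
  otherwise it is mixed with one of \<open>B i\<close>. The bound is linear in the size ratio, so it
  can be summed over \<open>i\<close> exactly.\<close>

lemma slice_exp_bound: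
  fixes A :: "('a \<Rightarrow> 'a) set" and l :: 'a and T :: "'a set"
  defines "B \<equiv> \<lambda>v. {\<rho>. \<rho> permutes T \<and> Transposition.transpose l v \<circ> \<rho> \<in> A}"
  assumes T: "finite T" "l \<notin> T" and i: "i \<in> insert l T"
    and B: "B l \<noteq> {}" "card (B i) \<le> card (B l)"
    and IH: "\<And>B v. B \<noteq> {} \<Longrightarrow> B \<subseteq> {\<rho>. \<rho> permutes T} \<Longrightarrow>
      hull_exp_bound T B (\<lambda>_ k. 1 + of_bool (k = v))"
  shows "\<exists>z. (\<forall>\<rho>. \<rho> permutes T \<longrightarrow> z \<rho> \<in> diff_hull (insert l T) A (Transposition.transpose l i \<circ> \<rho>)) \<and>
     real (card (B l)) * (\<Sum>\<rho> | \<rho> permutes T. exp ((\<Sum>k\<in>insert l T. (1 + of_bool (k = l)) * (z \<rho> k)\<^sup>2) / 144))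
     \<le> (2 - card (B i) / card (B l)) * (fact (card T))\<^sup>2"
proof -
  define P where "P = {\<rho>. \<rho> permutes T}"
  define M :: real where "M = (fact (card T))\<^sup>2"
  have BP: "B v \<subseteq> P" for v by (auto simp: B_def P_def)
  have finB: "finite (B v)" for v
    using finite_subset[OF BP] finite_permutations[OF T(1)] by (simp add: P_def)
  have b: "0 < card (B l)" using B(1) finB by (simp add: card_gt_0_iff)
  have sumS: "(\<Sum>k\<in>insert l T. (1 + of_bool (k = l)) * g k) = 2 * g l + sum g T" for g :: "'a \<Rightarrow> real"
  proof -
    have "(\<Sum>k\<in>T. (1 + of_bool (k = l)) * g k) = sum g T"
      using T by (intro sum.cong) auto
    with T show ?thesis by simp
  qed
  have "hull_exp_bound T (B l) (\<lambda>_ _. 1)"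
    by (rule hull_exp_bound_mono[OF IH[OF B(1)]]) (use BP in \<open>auto simp: P_def\<close>)
  then obtain x where x: "\<And>\<rho>. \<rho> \<in> P \<Longrightarrow> x \<rho> \<in> diff_hull T (B l) \<rho>"
    "real (card (B l)) * (\<Sum>\<rho>\<in>P. exp ((\<Sum>k\<in>T. (x \<rho> k)\<^sup>2) / 144)) \<le> M"
    unfolding hull_exp_bound_def P_def M_def by auto
  show ?thesis
  proof (cases "i = l")
    case True
    \<comment> \<open>The vacuous case fits the form of \<open>diff_hull_change\<close> with
      \<open>D\<close> empty.\<close>
    define z where "z \<rho> k = (if k \<in> {} then 1 else if k \<in> T then x \<rho> k else 0)" for \<rho> k
    have "z \<rho> \<in> diff_hull (insert l T) A (Transposition.transpose l i \<circ> \<rho>)" if "\<rho> \<in> P" for \<rho>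
      unfolding z_def
    proof (rule diff_hull_change[OF x(1)[OF that], where f = "\<lambda>\<tau>. \<tau>"])
      fix \<tau> k assume "\<tau> \<in> B l" "k \<in> insert l T - {}" "k \<in> T \<Longrightarrow> \<tau> k = \<rho> k"
      thus "\<tau> k = (Transposition.transpose l i \<circ> \<rho>) k"
        using that T True by (auto simp: B_def P_def permutes_not_in)
    qed (use T in \<open>auto simp: B_def\<close>)
    moreover have "(\<Sum>k\<in>insert l T. (1 + of_bool (k = l)) * (z \<rho> k)\<^sup>2) = (\<Sum>k\<in>T. (x \<rho> k)\<^sup>2)" for \<rho>
      unfolding sumS using T by (auto simp: z_def intro!: sum.cong)
    ultimately show ?thesis using x(2) b True
      by (intro exI[of _ z]) (simp add: P_def M_def)
  next
    case False
    with i have iT: "i \<in> T" by simp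
    have "hull_exp_bound T (B i) (\<lambda>\<sigma> k. 1 + of_bool (\<sigma> k = i))" if "B i \<noteq> {}"
    proof (rule hull_exp_bound_inv)
      show "hull_exp_bound T (inv ` B i) (\<lambda>_ k. 1 + of_bool (k = i))"
        using that by (intro IH) (auto simp: B_def permutes_inv)
    qed (simp add: B_def)
    \<comment> \<open>For empty \<open>B i\<close> the vector \<open>y\<close> is arbitrary; then
      \<open>r = 0\<close>, which forces \<open>\<theta> = 0\<close> below.\<close>
    then obtain y where y: "\<And>\<rho>. B i \<noteq> {} \<Longrightarrow> \<rho> \<in> P \<Longrightarrow> y \<rho> \<in> diff_hull T (B i) \<rho>"
      "B i \<noteq> {} \<Longrightarrow> real (card (B i)) * (\<Sum>\<rho>\<in>P. exp ((\<Sum>k\<in>T. (1 + of_bool (\<rho> k = i)) * (y \<rho> k)\<^sup>2) / 144)) \<le> M"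
      unfolding hull_exp_bound_def P_def M_def by (cases "B i = {}") auto
    define r :: real where "r = card (B i) / card (B l)"
    have r: "0 \<le> r" "r \<le> 1" using B(2) b by (auto simp: r_def)
    obtain \<theta> where \<theta>: "0 \<le> \<theta>" "\<theta> \<le> 1" "\<theta> = 0 \<or> 0 < r"
      "exp ((1 - \<theta>)\<^sup>2 / 36) * (\<theta> / r + (1 - \<theta>)) \<le> 2 - r"
      using interpolation_weight[OF r] .
    define u where "u = 1 - \<theta>"
    have u: "0 \<le> u" "u \<le> 1" "\<theta> + u = 1" using \<theta> by (auto simp: u_def)
    have Bi: "B i \<noteq> {}" if "\<theta> \<noteq> 0" using \<theta>(3) that by (auto simp: r_def)
    \<comment> \<open>Two ways into \<open>A\<close>. For \<open>y'\<close> the elements of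
      \<open>B i\<close> are moved by the same transposition as \<open>\<rho>\<close>, so all agree
      at \<open>l\<close>. For \<open>x'\<close> the elements of \<open>B l\<close> stay unmoved and
      may differ additionally at \<open>l\<close> and \<open>inv \<rho> i\<close>, whence the ones
      there.\<close>
    define y' where "y' \<rho> k = (if k \<in> {} then 1 else if k \<in> T then y \<rho> k else 0)" for \<rho> k
    define x' where "x' \<rho> k = (if k \<in> {l, inv \<rho> i} then 1 else if k \<in> T then x \<rho> k else 0)" for \<rho> k
    define z where "z \<rho> k = \<theta> * y' \<rho> k + (1 - \<theta>) * x' \<rho> k" for \<rho> k
    have x': "x' \<rho> \<in> diff_hull (insert l T) A (Transposition.transpose l i \<circ> \<rho>)" if \<rho>: "\<rho> \<in> P" for \<rho>
      unfolding x'_def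
    proof (rule diff_hull_change[OF x(1)[OF that], where f = "\<lambda>\<tau>. \<tau>"])
      have "inv \<rho> i \<in> T" using \<rho> iT permutes_in_image[OF permutes_inv, of \<rho> T i] by (simp add: P_def)
      thus "{l, inv \<rho> i} \<subseteq> insert l T" by simp
      fix \<tau> k assume k: "k \<in> insert l T - {l, inv \<rho> i}" "k \<in> T \<Longrightarrow> \<tau> k = \<rho> k"
      moreover have "\<rho> k \<noteq> i" using \<rho> k by (auto simp: P_def permutes_inverses)
      moreover have "\<rho> k \<noteq> l" using \<rho> k T permutes_in_image[of \<rho> T k] by (auto simp: P_def)
      ultimately show "\<tau> k = (Transposition.transpose l i \<circ> \<rho>) k" by (auto simp: Transposition.transpose_def)
    qed (use T in \<open>auto simp: B_def\<close>)
    have y': "y' \<rho> \<in> diff_hull (insert l T) A (Transposition.transpose l i \<circ> \<rho>)" if \<rho>: "\<rho> \<in> P" "\<theta> \<noteq> 0" for \<rho>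
      unfolding y'_def
    proof (rule diff_hull_change[OF y(1)[OF Bi[OF \<rho>(2)] \<rho>(1)], where f = "(\<circ>) (Transposition.transpose l i)"])
      fix \<tau> k assume "\<tau> \<in> B i" "k \<in> insert l T - {}" "k \<in> T \<Longrightarrow> \<tau> k = \<rho> k"
      thus "(Transposition.transpose l i \<circ> \<tau>) k = (Transposition.transpose l i \<circ> \<rho>) k"
        using \<rho> T by (auto simp: B_def P_def permutes_not_in)
    qed (use T in \<open>auto simp: B_def\<close>)
    have "z \<rho> \<in> diff_hull (insert l T) A (Transposition.transpose l i \<circ> \<rho>)" if "\<rho> \<in> P" for \<rho>
    proof (cases "\<theta> = 0")
      case True
      thus ?thesis using x'[OF that] by (simp add: z_def[abs_def])
    next
      case False
      thus ?thesis using diff_hull_convex[OF x'[OF that] y'[OF that] \<theta>(1,2)] by (simp add: z_def[abs_def])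
    qed
    moreover have "real (card (B l)) * (\<Sum>\<rho>\<in>P. exp ((\<Sum>k\<in>insert l T. (1 + of_bool (k = l)) * (z \<rho> k)\<^sup>2) / 144)) \<le> (2 - r) * M"
    proof -
      define X where "X \<rho> = (\<Sum>k\<in>T. (x \<rho> k)\<^sup>2) / 144" for \<rho>
      define Y where "Y \<rho> = (\<Sum>k\<in>T. (1 + of_bool (\<rho> k = i)) * (y \<rho> k)\<^sup>2) / 144" for \<rho>
      have pt: "exp ((\<Sum>k\<in>insert l T. (1 + of_bool (k = l)) * (z \<rho> k)\<^sup>2) / 144)
        \<le> exp (u\<^sup>2 / 36) * (\<theta> * exp (Y \<rho>) + u * exp (X \<rho>))" if \<rho>: "\<rho> \<in> P" for \<rho>
      proof -
        define m where "m = inv \<rho> i"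
        have mT: "m \<in> T" using \<rho> iT permutes_in_image[OF permutes_inv, of \<rho> T i] by (simp add: P_def m_def)
        have m: "\<rho> k = i \<longleftrightarrow> k = m" for k
          using \<rho> by (auto simp: P_def permutes_inverses m_def)
        have zl: "z \<rho> l = u" using T by (simp add: z_def y'_def x'_def u_def)
        \<comment> \<open>At \<open>m\<close> the bound
          \<open>(a + b)\<^sup>2 \<le> 2 * a\<^sup>2 + 2 * b\<^sup>2\<close> uses up the second copy
          of \<open>y \<rho> m\<close>; elsewhere convexity of the square is enough. The extra
          \<open>2 * u\<^sup>2\<close> joins the \<open>2 * u\<^sup>2\<close> of the doubled
          coordinate \<open>l\<close>, and \<open>4 / 144 = 1 / 36\<close>.\<close>
        have zk: "(z \<rho> k)\<^sup>2 \<le> \<theta> * ((1 + of_bool (\<rho> k = i)) * (y \<rho> k)\<^sup>2) + u * (x \<rho> k)\<^sup>2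
            + (if k = m then 2 * u\<^sup>2 else 0)" if k: "k \<in> T" for k
        proof (cases "k = m")
          case True
          have z: "z \<rho> k = \<theta> * y \<rho> k + u"
            using True k T by (simp add: z_def y'_def x'_def u_def m_def)
          have "0 \<le> (\<theta> * y \<rho> k - u)\<^sup>2" by simp
          hence "(z \<rho> k)\<^sup>2 \<le> 2 * (\<theta>\<^sup>2 * (y \<rho> k)\<^sup>2) + 2 * u\<^sup>2"
            unfolding z by (simp add: power2_eq_square algebra_simps)
          moreover have "\<theta>\<^sup>2 * (y \<rho> k)\<^sup>2 \<le> \<theta> * (y \<rho> k)\<^sup>2"
            using \<theta> by (intro mult_right_mono) (auto simp: power2_eq_square mult_left_le)
          moreover have "0 \<le> u * (x \<rho> k)\<^sup>2" using u by simp
          ultimately show ?thesis using True by (simp add: m)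
        next
          case False
          have z: "z \<rho> k = \<theta> * y \<rho> k + u * x \<rho> k"
            using False k T by (auto simp: z_def y'_def x'_def u_def m_def)
          have "\<theta> * (y \<rho> k)\<^sup>2 + u * (x \<rho> k)\<^sup>2 - (z \<rho> k)\<^sup>2 = \<theta> * u * (y \<rho> k - x \<rho> k)\<^sup>2"
            unfolding z u_def by (simp add: power2_eq_square algebra_simps)
          moreover have "0 \<le> \<theta> * u * (y \<rho> k - x \<rho> k)\<^sup>2" using \<theta> u by simp
          ultimately show ?thesis using False by (simp add: m)
        qed
        have "(\<Sum>k\<in>insert l T. (1 + of_bool (k = l)) * (z \<rho> k)\<^sup>2) \<le> 2 * u\<^sup>2 +
          (\<Sum>k\<in>T. \<theta> * ((1 + of_bool (\<rho> k = i)) * (y \<rho> k)\<^sup>2) + u * (x \<rho> k)\<^sup>2 + (if k = m then 2 * u\<^sup>2 else 0))"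
          unfolding sumS zl by (intro add_left_mono sum_mono zk)
        also have "\<dots> = 4 * u\<^sup>2 + \<theta> * (144 * Y \<rho>) + u * (144 * X \<rho>)"
          using T mT by (simp add: sum.distrib X_def Y_def flip: sum_distrib_left)
        finally have "exp ((\<Sum>k\<in>insert l T. (1 + of_bool (k = l)) * (z \<rho> k)\<^sup>2) / 144)
           \<le> exp (u\<^sup>2 / 36 + (\<theta> * Y \<rho> + u * X \<rho>))" by simp
        also have "\<dots> = exp (u\<^sup>2 / 36) * exp (\<theta> * Y \<rho> + u * X \<rho>)" by (rule exp_add)
        also have "exp (\<theta> * Y \<rho> + u * X \<rho>) \<le> \<theta> * exp (Y \<rho>) + u * exp (X \<rho>)"
          using convex_onD[OF exp_convex, of u "Y \<rho>" "X \<rho>"] u by (simp add: u_def)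
        finally show ?thesis by simp
      qed
      \<comment> \<open>Replacing \<open>card (B i)\<close> by the larger \<open>card (B l)\<close>
        costs the factor \<open>1 / r\<close>.\<close>
      have Yb: "\<theta> * (real (card (B l)) * (\<Sum>\<rho>\<in>P. exp (Y \<rho>))) \<le> \<theta> / r * M"
      proof (cases "\<theta> = 0")
        case False
        hence "0 < card (B i)" using Bi finB by (simp add: card_gt_0_iff)
        moreover have "real (card (B i)) * (\<Sum>\<rho>\<in>P. exp (Y \<rho>)) \<le> M"
          using y(2)[OF Bi[OF False]] by (simp add: Y_def)
        ultimately have "real (card (B l)) * (\<Sum>\<rho>\<in>P. exp (Y \<rho>)) \<le> M / r"
          using b by (simp add: r_def field_simps)
        from mult_left_mono[OF this \<theta>(1)] show ?thesis by simp
      qed simp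
      have "real (card (B l)) * (\<Sum>\<rho>\<in>P. exp ((\<Sum>k\<in>insert l T. (1 + of_bool (k = l)) * (z \<rho> k)\<^sup>2) / 144))
        \<le> real (card (B l)) * (\<Sum>\<rho>\<in>P. exp (u\<^sup>2 / 36) * (\<theta> * exp (Y \<rho>) + u * exp (X \<rho>)))"
        by (intro mult_left_mono sum_mono pt) auto
      also have "\<dots> = exp (u\<^sup>2 / 36) * (\<theta> * (real (card (B l)) * (\<Sum>\<rho>\<in>P. exp (Y \<rho>)))
          + u * (real (card (B l)) * (\<Sum>\<rho>\<in>P. exp (X \<rho>))))"
        by (simp add: sum.distrib flip: sum_distrib_left) (simp add: algebra_simps)
      also have "\<dots> \<le> exp (u\<^sup>2 / 36) * (\<theta> / r * M + u * M)"
        using x(2) Yb u by (intro mult_left_mono add_mono) (auto simp: X_def)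
      also have "\<dots> = (exp (u\<^sup>2 / 36) * (\<theta> / r + u)) * M" by (simp add: algebra_simps)
      also have "\<dots> \<le> (2 - r) * M"
        using \<theta>(4) by (intro mult_right_mono) (auto simp: u_def M_def)
      finally show ?thesis .
    qed
    ultimately show ?thesis by (intro exI[of _ z]) (simp add: P_def M_def r_def)
  qed
qed

section \<open>Summation over the slices\<close>

text \<open>The slice bounds sum to \<open>2 * N - q\<close>, where \<open>q\<close> is the ratio of
  \<open>card A\<close> to \<open>card (B l)\<close>. Multiplying by \<open>q\<close> and completing
  the square leaves at most \<open>N\<^sup>2\<close>, exactly the growth of the squared
  factorial.\<close>

lemma hull_exp_bound_insert:
  fixes A :: "('a \<Rightarrow> 'a) set" and l :: 'a and T :: "'a set"
  defines "B \<equiv> \<lambda>v. {\<rho>. \<rho> permutes T \<and> Transposition.transpose l v \<circ> \<rho> \<in> A}"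
  assumes T: "finite T" "l \<notin> T" and A: "A \<subseteq> {\<sigma>. \<sigma> permutes (insert l T)}"
    and B: "B l \<noteq> {}" "\<And>i. i \<in> insert l T \<Longrightarrow> card (B i) \<le> card (B l)"
    and IH: "\<And>B v. B \<noteq> {} \<Longrightarrow> B \<subseteq> {\<rho>. \<rho> permutes T} \<Longrightarrow>
      hull_exp_bound T B (\<lambda>_ k. 1 + of_bool (k = v))"
  shows "hull_exp_bound (insert l T) A (\<lambda>_ k. 1 + of_bool (k = l))"
proof -
  let ?S = "insert l T"
  define M :: real where "M = (fact (card T))\<^sup>2"
  define N where "N = real (card ?S)"
  have finP: "finite {\<rho>. \<rho> permutes T}" using T finite_permutations by blast
  have finB: "finite (B v)" for v by (rule finite_subset[OF _ finP]) (auto simp: B_def)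
  have b: "0 < card (B l)" using B(1) finB by (simp add: card_gt_0_iff)
  obtain z where z: "\<And>i \<rho>. i \<in> ?S \<Longrightarrow> \<rho> permutes T \<Longrightarrow> z i \<rho> \<in> diff_hull ?S A (Transposition.transpose l i \<circ> \<rho>)"
     "\<And>i. i \<in> ?S \<Longrightarrow> real (card (B l)) * (\<Sum>\<rho> | \<rho> permutes T. exp ((\<Sum>k\<in>?S. (1 + of_bool (k = l)) * (z i \<rho> k)\<^sup>2) / 144))
     \<le> (2 - card (B i) / card (B l)) * M"
  proof -
    have "\<forall>i\<in>?S. \<exists>z. (\<forall>\<rho>. \<rho> permutes T \<longrightarrow> z \<rho> \<in> diff_hull (insert l T) A (Transposition.transpose l i \<circ> \<rho>)) \<and>
     real (card (B l)) * (\<Sum>\<rho> | \<rho> permutes T. exp ((\<Sum>k\<in>insert l T. (1 + of_bool (k = l)) * (z \<rho> k)\<^sup>2) / 144))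
     \<le> (2 - card (B i) / card (B l)) * M"
      unfolding B_def M_def
      by (intro ballI slice_exp_bound T IH B[unfolded B_def]) auto
    from bchoice[OF this] show ?thesis using that by blast
  qed
  \<comment> \<open>Composing with the transposition of \<open>l\<close> and
    \<open>\<sigma> l\<close> recovers the \<open>T\<close>-part of \<open>\<sigma>\<close>, which
    glues the families \<open>z i\<close> into one.\<close>
  define x where "x \<sigma> = z (\<sigma> l) (Transposition.transpose l (\<sigma> l) \<circ> \<sigma>)" for \<sigma>
  define E where "E \<sigma> = exp ((\<Sum>k\<in>?S. (1 + of_bool (k = l)) * (x \<sigma> k)\<^sup>2) / 144)" for \<sigma>
  have hull: "x \<sigma> \<in> diff_hull ?S A \<sigma>" if "\<sigma> permutes ?S" for \<sigma>
  proof -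
    have "\<sigma> l \<in> ?S" using permutes_in_image[OF that] by blast
    from z(1)[OF this permutes_insert_lemma[OF that]] show ?thesis
      by (simp add: x_def o_assoc)
  qed
  have x_slice: "x (Transposition.transpose l i \<circ> \<rho>) = z i \<rho>" if "\<rho> permutes T" for i \<rho>
    using permutes_not_in[OF that T(2)] by (simp add: x_def o_assoc)
  have "card A = (\<Sum>\<sigma> | \<sigma> permutes ?S. of_bool (\<sigma> \<in> A))"
    using finite_permutations[of ?S] T A by (simp add: Int_absorb1)
  also have "\<dots> = (\<Sum>i\<in>?S. \<Sum>\<rho> | \<rho> permutes T. of_bool (Transposition.transpose l i \<circ> \<rho> \<in> A))"
    by (rule sum_over_permutations_insert[OF T])
  also have "\<dots> = (\<Sum>i\<in>?S. card (B i))"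
    using finP by (intro sum.cong refl) (auto simp: B_def Int_def)
  finally have cardA: "card A = (\<Sum>i\<in>?S. card (B i))" .
  define q where "q = real (card A) / card (B l)"
  have "real (card (B l)) * (\<Sum>\<sigma> | \<sigma> permutes ?S. E \<sigma>)
      = (\<Sum>i\<in>?S. real (card (B l)) * (\<Sum>\<rho> | \<rho> permutes T. E (Transposition.transpose l i \<circ> \<rho>)))"
    by (simp add: sum_over_permutations_insert[OF T] sum_distrib_left)
  also have "\<dots> \<le> (\<Sum>i\<in>?S. (2 - card (B i) / card (B l)) * M)"
  proof (rule sum_mono)
    fix i assume "i \<in> ?S"
    from z(2)[OF this] show "real (card (B l)) * (\<Sum>\<rho> | \<rho> permutes T. E (Transposition.transpose l i \<circ> \<rho>)) \<le> (2 - card (B i) / card (B l)) * M"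
      by (simp add: E_def x_slice)
  qed
  also have "\<dots> = (2 * N - q) * M"
    by (simp add: q_def cardA N_def sum_subtractf sum_divide_distrib flip: sum_distrib_right)
  finally have le: "real (card (B l)) * (\<Sum>\<sigma> | \<sigma> permutes ?S. E \<sigma>) \<le> (2 * N - q) * M" .
  have "real (card A) * (\<Sum>\<sigma> | \<sigma> permutes ?S. E \<sigma>) = q * (real (card (B l)) * (\<Sum>\<sigma> | \<sigma> permutes ?S. E \<sigma>))"
    using b by (simp add: q_def)
  also have "\<dots> \<le> q * ((2 * N - q) * M)"
    using le by (intro mult_left_mono) (auto simp: q_def)
  also have "\<dots> = (N\<^sup>2 - (N - q)\<^sup>2) * M" by (simp add: power2_eq_square algebra_simps)
  also have "\<dots> \<le> N\<^sup>2 * M" by (intro mult_right_mono) (auto simp: M_def)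
  also have "\<dots> = (fact (card ?S))\<^sup>2"
    using T by (simp add: N_def M_def power_mult_distrib)
  finally show ?thesis using hull unfolding hull_exp_bound_def E_def by blast
qed

text \<open>Left multiplication by the transposition of \<open>l\<close> and \<open>v\<close> is an
  involution exchanging the permutations that fix \<open>l\<close> with those sending
  \<open>l\<close> to \<open>v\<close>.\<close>

lemma card_slice:
  assumes "l \<notin> T" "A \<subseteq> {\<sigma>. \<sigma> permutes (insert l T)}"
  shows "card {\<rho>. \<rho> permutes T \<and> Transposition.transpose l v \<circ> \<rho> \<in> A} = card {\<sigma>\<in>A. \<sigma> l = v}"
proof (rule bij_betw_same_card[of "(\<circ>) (Transposition.transpose l v)"], rule bij_betwI')
  show "Transposition.transpose l v \<circ> \<rho> = Transposition.transpose l v \<circ> \<rho>' \<longleftrightarrow> \<rho> = \<rho>'" for \<rho> \<rho>' :: "'a \<Rightarrow> 'a"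
    by (metis comp_assoc id_comp transpose_comp_involutory)
  show "Transposition.transpose l v \<circ> \<rho> \<in> {\<sigma>\<in>A. \<sigma> l = v}"
    if "\<rho> \<in> {\<rho>. \<rho> permutes T \<and> Transposition.transpose l v \<circ> \<rho> \<in> A}" for \<rho>
    using that assms(1) by (auto simp: permutes_not_in)
  show "\<exists>\<rho>\<in>{\<rho>. \<rho> permutes T \<and> Transposition.transpose l v \<circ> \<rho> \<in> A}. \<sigma> = Transposition.transpose l v \<circ> \<rho>"
    if "\<sigma> \<in> {\<sigma>\<in>A. \<sigma> l = v}" for \<sigma>
    using that assms(2) permutes_insert_lemma[of \<sigma> l T]
    by (intro bexI[of _ "Transposition.transpose l v \<circ> \<sigma>"]) (auto simp: o_assoc)
qed

section \<open>Induction on the number of points\<close>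

text \<open>Both \<open>A\<close> and the doubled coordinate \<open>v\<close> stay general, since
  the step applies the hypothesis to slices and to inverses of slices, with varying
  \<open>v\<close>. For \<open>v\<close> outside \<open>S\<close> nothing is doubled, and doubling
  any \<open>l\<close> in \<open>S\<close> gives a stronger bound.\<close>

theorem hull_exp_bound_permutations:
  assumes "finite S" "A \<noteq> {}" "A \<subseteq> {\<sigma>. \<sigma> permutes S}"
  shows "hull_exp_bound S A (\<lambda>_ k. 1 + of_bool (k = v))"
  using assms
proof (induction "card S" arbitrary: S A v)
  case 0
  hence "S = {}" "A = {id}" by auto
  thus ?case by (auto simp: hull_exp_bound_def diff_hull_def)
next
  case (Suc n)
  have main: "hull_exp_bound S A (\<lambda>_ k. 1 + of_bool (k = l))" if l: "l \<in> S" for l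
  proof -
    define T where "T = S - {l}"
    have T: "finite T" "l \<notin> T" and S: "S = insert l T" and n: "n = card T"
      using Suc l by (auto simp: T_def)
    define slice where "slice v = {\<sigma>\<in>A. \<sigma> l = v}" for v
    have "finite A" using Suc.prems finite_permutations finite_subset by blast
    hence fin: "finite (slice v)" for v by (simp add: slice_def)
    let ?C = "(\<lambda>v. card (slice v)) ` S"
    have "Max ?C \<in> ?C" using Suc.prems l by (intro Max_in) auto
    then obtain j where j: "j \<in> S" "Max ?C = card (slice j)" by blast
    have max: "card (slice i) \<le> card (slice j)" if "i \<in> S" for i
      unfolding j(2)[symmetric] using that Suc.prems by (intro Max_ge) auto
    \<comment> \<open>Swapping the values \<open>l\<close> and \<open>j\<close> makes the largest
      slice the one with value \<open>l\<close>.\<close>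
    define \<pi> where "\<pi> = Transposition.transpose l j"
    have \<pi>: "\<pi> permutes S" using j l by (simp add: \<pi>_def permutes_swap_id)
    define A' where "A' = (\<circ>) \<pi> ` A"
    have A': "A' \<subseteq> {\<sigma>. \<sigma> permutes (insert l T)}"
      using Suc.prems permutes_compose[OF _ \<pi>] by (auto simp: A'_def S[symmetric])
    have card: "card {\<rho>. \<rho> permutes T \<and> Transposition.transpose l v \<circ> \<rho> \<in> A'} = card (slice (\<pi> v))" for v
    proof -
      have "{\<sigma>\<in>A'. \<sigma> l = v} = (\<circ>) \<pi> ` slice (\<pi> v)"
        by (auto simp: A'_def slice_def \<pi>_def)
      moreover have "inj_on ((\<circ>) \<pi>) (slice (\<pi> v))"
        by (rule inj_onI) (metis permutes_inj[OF \<pi>] fun.inj_map_strong inj_eq)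
      ultimately show ?thesis
        unfolding card_slice[OF T(2) A'] by (simp add: card_image)
    qed
    obtain \<sigma> where \<sigma>: "\<sigma> \<in> A" using Suc.prems by blast
    hence "\<sigma> permutes S" using Suc.prems by blast
    hence "\<sigma> l \<in> S" using permutes_in_image[of \<sigma> S l] l by simp
    moreover have "0 < card (slice (\<sigma> l))" using \<sigma> fin by (auto simp: card_gt_0_iff slice_def)
    ultimately have pos: "0 < card (slice j)" using max[of "\<sigma> l"] by linarith
    have "hull_exp_bound (insert l T) A' (\<lambda>_ k. 1 + of_bool (k = l))"
    proof (rule hull_exp_bound_insert[OF T A'])
      have "card {\<rho>. \<rho> permutes T \<and> Transposition.transpose l l \<circ> \<rho> \<in> A'} > 0"
        unfolding card using pos by (simp add: \<pi>_def)
      thus "{\<rho>. \<rho> permutes T \<and> Transposition.transpose l l \<circ> \<rho> \<in> A'} \<noteq> {}" by (metis card.empty less_irrefl)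
      fix i assume "i \<in> insert l T"
      hence "\<pi> i \<in> S" using permutes_in_image[OF \<pi>] S by blast
      thus "card {\<rho>. \<rho> permutes T \<and> Transposition.transpose l i \<circ> \<rho> \<in> A'}
          \<le> card {\<rho>. \<rho> permutes T \<and> Transposition.transpose l l \<circ> \<rho> \<in> A'}"
        unfolding card using max by (simp add: \<pi>_def)
    next
      show "hull_exp_bound T B (\<lambda>_ k. 1 + of_bool (k = v))"
        if "B \<noteq> {}" "B \<subseteq> {\<rho>. \<rho> permutes T}" for B v
        using Suc.hyps(1)[OF n T(1) that] .
    qed
    thus ?thesis unfolding S[symmetric] A'_def by (rule hull_exp_bound_left_mult[OF \<pi>])
  qed
  show ?case
  proof (cases "v \<in> S")
    case True
    thus ?thesis by (rule main)
  next
    case False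
    from Suc obtain l where "l \<in> S" by fastforce
    from main[OF this] show ?thesis
      by (rule hull_exp_bound_mono) (use False in auto)
  qed
qed

section \<open>Passage to the uniform distribution\<close>

theorem proposition1p8:
  fixes n :: nat and A :: "(nat \<Rightarrow> nat) set"
  assumes "n \<ge> 1" and "A \<subseteq> Sym n" and "A \<noteq> {}"
  shows "measure_pmf.prob (unif_Sym n) A *
         measure_pmf.expectation (unif_Sym n) (\<lambda>\<sigma>. exp ((d_T n \<sigma> A)\<^sup>2 / 144)) \<le> 1"
proof -
  have fin: "finite (Sym n)" and card: "card (Sym n) = fact n" and ne: "Sym n \<noteq> {}"
    using finite_permutations[of "{1..n}"] card_permutations[of "{1..n}" n] assms(2,3)
    by (auto simp: Sym_def)
  \<comment> \<open>The point 0 lies outside \<open>{1..n}\<close>, so no coordinate is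
    doubled.\<close>
  have "hull_exp_bound {1..n} A (\<lambda>_ k. 1 + of_bool (k = 0))"
    using assms by (intro hull_exp_bound_permutations) (auto simp: Sym_def)
  hence "hull_exp_bound {1..n} A (\<lambda>_ _. 1)" by (rule hull_exp_bound_mono) simp
  then obtain x where x: "\<And>\<sigma>. \<sigma> \<in> Sym n \<Longrightarrow> x \<sigma> \<in> diff_hull {1..n} A \<sigma>"
    "real (card A) * (\<Sum>\<sigma>\<in>Sym n. exp ((\<Sum>k=1..n. (x \<sigma> k)\<^sup>2) / 144)) \<le> (fact n)\<^sup>2"
    unfolding hull_exp_bound_def by (auto simp: Sym_def)
  have "real (card A) * (\<Sum>\<sigma>\<in>Sym n. exp ((d_T n \<sigma> A)\<^sup>2 / 144)) \<le> (fact n)\<^sup>2"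
    using d_T_le[OF assms(1,3) x(1)]
    by (intro order_trans[OF _ x(2)] mult_left_mono sum_mono) auto
  moreover have "measure_pmf.prob (unif_Sym n) A = card A / fact n"
    unfolding unif_Sym_def using assms(2) fin ne card
    by (simp add: measure_pmf_of_set Int_absorb1)
  moreover have "measure_pmf.expectation (unif_Sym n) (\<lambda>\<sigma>. exp ((d_T n \<sigma> A)\<^sup>2 / 144))
      = (\<Sum>\<sigma>\<in>Sym n. exp ((d_T n \<sigma> A)\<^sup>2 / 144)) / fact n"
    unfolding unif_Sym_def using integral_pmf_of_set[OF ne fin] card by simp
  ultimately show ?thesis by (simp add: power2_eq_square)
qed

end
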